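(* Let $\phi_1$ be the Laplace transform of a probability distribution on $[0,\infty)$ and let $P_1(s)=\phi_1(1-s)$, $0<s<1$. Then $P_1$ is a compound of Bernoulli laws: there exist $0<b<1$ and a probability generating function $P_2$ such that $P_1(s)=P_2(1-b+bs)$ for all $0<s<1$.
   Context: Probability generating functions are those of probability distributions on $\{0,1,2,\dots\}$. The Bernoulli law with parameter $b$ has probability generating function $1-b+bs$. *)

theory Defs
  imports "HOL-Probability.Probability"
begin

definition laplace_transform :: "real measure \<Rightarrow> real \<Rightarrow> real" where
  "laplace_transform M t = (\<integral>x. exp (- t * x) \<partial>M)"

text \<open>Laplace transforms are only constrained on \<open>[0, \<infinity>)\<close> and probability generating functions
  only on \<open>[0, 1]\<close>; the values of the HOL functions elsewhere are irrelevant.\<close>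

definition is_laplace_transform :: "(real \<Rightarrow> real) \<Rightarrow> bool" where
  "is_laplace_transform \<phi> \<longleftrightarrow>
     (\<exists>M. real_distribution M \<and> measure M {0..} = 1 \<and> (\<forall>t\<ge>0. \<phi> t = laplace_transform M t))"

definition pgf :: "nat pmf \<Rightarrow> real \<Rightarrow> real" where
  "pgf p s = (\<Sum>n. pmf p n * s ^ n)"

definition is_pgf :: "(real \<Rightarrow> real) \<Rightarrow> bool" where
  "is_pgf P \<longleftrightarrow> (\<exists>p. \<forall>s\<in>{0..1}. P s = pgf p s)"

end

theory Submission
  imports Defs
begin

text \<open>If \<open>X \<ge> 0\<close> has Laplace transform \<open>\<phi>\<^sub>1\<close>, then the mixed Poisson law with random intensity
  \<open>X / b\<close> has probability generating function \<open>u \<mapsto> \<phi>\<^sub>1 ((1 - u) / b)\<close>. At \<open>u = 1 - b + b s\<close> this is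
  \<open>\<phi>\<^sub>1 (1 - s)\<close>, so every \<open>b \<in> (0, 1)\<close> works.\<close>

definition mixed_poisson_weight :: "real measure \<Rightarrow> real \<Rightarrow> nat \<Rightarrow> real" where
  "mixed_poisson_weight M c n = (\<integral>x. exp (- (c * x)) * (c * x) ^ n / fact n \<partial>M)"

text \<open>Each \<open>s ^ n\<close> is at most 1, so the sum is bounded by the total mass of the
  Poisson law with mean \<open>y\<close>. The bound is uniform in \<open>y\<close> and
  \<open>k\<close>, which makes the constant 1 a dominating function.\<close>

lemma poisson_partial_sum_bounds:
  fixes y s :: real
  assumes "0 \<le> y" "0 \<le> s" "s \<le> 1"
  shows "0 \<le> (\<Sum>n<k. exp (- y) * y ^ n / fact n * s ^ n)"
    and "(\<Sum>n<k. exp (- y) * y ^ n / fact n * s ^ n) \<le> 1"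
proof -
  show "0 \<le> (\<Sum>n<k. exp (- y) * y ^ n / fact n * s ^ n)"
    using assms by (intro sum_nonneg) auto
  have "(\<Sum>n<k. exp (- y) * y ^ n / fact n * s ^ n) \<le> (\<Sum>n<k. exp (- y) * (y ^ n /\<^sub>R fact n))"
    using assms by (intro sum_mono) (auto simp: field_simps power_le_one intro!: mult_left_le_one_le)
  also have "\<dots> = exp (- y) * (\<Sum>n<k. y ^ n /\<^sub>R fact n)"
    by (simp add: sum_distrib_left)
  also have "\<dots> \<le> exp (- y) * exp y"
    using sum_le_suminf[OF summable_exp_generic, of "{..<k}" y] exp_converges[of y] assms
    by (intro mult_left_mono) (auto simp: sums_iff)
  also have "\<dots> = 1"
    by (simp add: exp_minus)
  finally show "(\<Sum>n<k. exp (- y) * y ^ n / fact n * s ^ n) \<le> 1" .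
qed

lemma poisson_pgf_sums:
  fixes y s :: real
  shows "(\<lambda>n. exp (- y) * y ^ n / fact n * s ^ n) sums exp (- (1 - s) * y)"
proof -
  have "(\<lambda>n. exp (- y) * ((y * s) ^ n /\<^sub>R fact n)) sums (exp (- y) * exp (y * s))"
    by (intro sums_mult exp_converges)
  then show ?thesis
    by (simp add: field_simps power_mult_distrib flip: exp_add)
qed

text \<open>Integrating the Poisson generating function over the intensity \<open>c * x\<close>
  gives a Laplace transform. Dominated convergence of the partial sums exchanges series and
  integral.\<close>

lemma mixed_poisson_sums:
  assumes M: "real_distribution M" "AE x in M. 0 \<le> x" and c: "0 \<le> c" and s: "0 \<le> s" "s \<le> 1"
  shows "(\<lambda>n. mixed_poisson_weight M c n * s ^ n) sums laplace_transform M (c * (1 - s))"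
proof -
  interpret real_distribution M by fact
  have integrable_weight: "integrable M (\<lambda>x. exp (- (c * x)) * (c * x) ^ n / fact n)" for n
  proof (rule integrable_const_bound[where B = 1])
    show "AE x in M. norm (exp (- (c * x)) * (c * x) ^ n / fact n) \<le> 1"
      using M(2)
    proof eventually_elim
      case (elim x)
      \<comment> \<open>A single weight is the last term of a partial sum at \<open>s = 1\<close>;
        the earlier terms are nonnegative in total.\<close>
      have "exp (- (c * x)) * (c * x) ^ n / fact n
          \<le> (\<Sum>i<Suc n. exp (- (c * x)) * (c * x) ^ i / fact i * 1 ^ i)"
        using poisson_partial_sum_bounds(1)[of "c * x" 1 n] elim c by simp
      also have "\<dots> \<le> 1"
        using elim c by (intro poisson_partial_sum_bounds) auto
      finally show ?case
        using elim c by simp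
    qed
  qed simp
  have "(\<lambda>k. \<integral>x. (\<Sum>n<k. exp (- (c * x)) * (c * x) ^ n / fact n * s ^ n) \<partial>M)
      \<longlonglongrightarrow> (\<integral>x. exp (- (1 - s) * (c * x)) \<partial>M)"
  proof (rule integral_dominated_convergence[where w = "\<lambda>_. 1"])
    show "AE x in M. (\<lambda>k. \<Sum>n<k. exp (- (c * x)) * (c * x) ^ n / fact n * s ^ n)
        \<longlonglongrightarrow> exp (- (1 - s) * (c * x))"
      using poisson_pgf_sums unfolding sums_def by simp
    show "AE x in M. norm (\<Sum>n<k. exp (- (c * x)) * (c * x) ^ n / fact n * s ^ n) \<le> 1" for k
      using M(2)
    proof eventually_elim
      case (elim x)
      then show ?case
        using poisson_partial_sum_bounds[of "c * x" s k] c s by simp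
    qed
  qed simp_all
  moreover have "(\<integral>x. (\<Sum>n<k. exp (- (c * x)) * (c * x) ^ n / fact n * s ^ n) \<partial>M)
      = (\<Sum>n<k. mixed_poisson_weight M c n * s ^ n)" for k
    \<comment> \<open>Deleting \<open>times_divide_eq_left\<close> keeps \<open>s ^ n\<close> as a
      separate right factor, so that it can be pulled out of the integral.\<close>
    unfolding mixed_poisson_weight_def
    by (subst Bochner_Integration.integral_sum)
      (use integrable_weight in \<open>auto intro!: integrable_mult_left simp del: times_divide_eq_left\<close>)
  moreover have "(\<integral>x. exp (- (1 - s) * (c * x)) \<partial>M) = laplace_transform M (c * (1 - s))"
    unfolding laplace_transform_def by (simp add: algebra_simps)
  ultimately show ?thesis
    unfolding sums_def by simp
qed

lemma mixed_poisson_is_pgf: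
  assumes M: "real_distribution M" "AE x in M. 0 \<le> x" and c: "0 \<le> c"
  shows "is_pgf (\<lambda>u. laplace_transform M (c * (1 - u)))"
proof -
  interpret real_distribution M by fact
  have nonneg: "0 \<le> mixed_poisson_weight M c n" for n
    unfolding mixed_poisson_weight_def
    using M(2) by (intro integral_nonneg_AE) (auto elim!: eventually_mono simp: c)
  \<comment> \<open>At \<open>s = 1\<close> the transform is taken at 0, where it equals the total
    mass of \<open>M\<close>.\<close>
  have "mixed_poisson_weight M c sums 1"
    using mixed_poisson_sums[OF M c, of 1] prob_space by (simp add: laplace_transform_def)
  \<comment> \<open>This is the normalisation, in the form required by \<open>pmf_embed_pmf\<close>,
    that makes \<open>embed_pmf\<close> return the given weights.\<close>
  then have "(\<integral>\<^sup>+n. ennreal (mixed_poisson_weight M c n) \<partial>count_space UNIV) = 1"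
    using suminf_ennreal_eq[OF nonneg] by (simp add: nn_integral_count_space_nat)
  then have "pmf (embed_pmf (mixed_poisson_weight M c)) n = mixed_poisson_weight M c n" for n
    using nonneg by (intro pmf_embed_pmf) auto
  then show ?thesis
    unfolding is_pgf_def pgf_def using mixed_poisson_sums[OF M c]
    by (intro exI[of _ "embed_pmf (mixed_poisson_weight M c)"]) (auto simp: sums_iff)
qed

theorem theorem3p3:
  fixes \<phi>1 P1 :: "real \<Rightarrow> real"
  assumes "is_laplace_transform \<phi>1"
    and "\<And>s. 0 < s \<Longrightarrow> s < 1 \<Longrightarrow> P1 s = \<phi>1 (1 - s)"
  shows "\<exists>b P2. 0 < b \<and> b < 1 \<and> is_pgf P2 \<and>
           (\<forall>s. 0 < s \<and> s < 1 \<longrightarrow> P1 s = P2 (1 - b + b * s))"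
proof -
  obtain M where M: "real_distribution M" "measure M {0..} = 1"
    and \<phi>1: "\<And>t. 0 \<le> t \<Longrightarrow> \<phi>1 t = laplace_transform M t"
    using assms(1) unfolding is_laplace_transform_def by blast
  interpret real_distribution M by fact
  have "AE x in M. 0 \<le> x"
    using AE_in_set_eq_1[of "{0..}"] M(2) by simp
  then have "is_pgf (\<lambda>u. laplace_transform M (2 * (1 - u)))"
    using M(1) by (intro mixed_poisson_is_pgf) auto
  \<comment> \<open>The choice is b = 1/2, hence intensity factor \<open>c = 2\<close>, the
    reciprocal of b; the argument reduces to \<open>1 - s\<close>.\<close>
  moreover have "P1 s = laplace_transform M (2 * (1 - (1 - 1 / 2 + 1 / 2 * s)))"
    if "0 < s" "s < 1" for s
    using assms(2) \<phi>1 that by (simp add: algebra_simps)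
  ultimately show ?thesis
    by (intro exI[of _ "1 / 2"] exI[of _ "\<lambda>u. laplace_transform M (2 * (1 - u))"]) auto
qed

end
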